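(* The twist of the coupled spin-oscillator vanishes on the energy surface $H=0$; that is, $\mathcal{T}(l,0)=0$ for every $l$ such that $(l,0)$ is a regular value of $F=(L,H)$ in the image $F(M)$.
   Context: Coupled spin-oscillator: $M=\mathbb{S}^2\times\mathbb{R}^2$ with Cartesian coordinates $(x,y,z)$ on the unit sphere $\mathbb{S}^2\subset\mathbb{R}^3$ and $(u,v)$ on $\mathbb{R}^2$, symplectic form $\omega=\lambda\,\omega_{\mathbb{S}^2}\oplus\mu\,\omega_{\mathbb{R}^2}$ with $\lambda,\mu>0$ constants and $\omega_{\mathbb{S}^2},\omega_{\mathbb{R}^2}$ the standard symplectic structures, and momentum map $F=(L,H)$, $$L=\mu\frac{u^2+v^2}{2}+\lambda(z-1),\qquad H=\frac{xu+yv}{2}.$$ The values of $L$ and $H$ are denoted $l$ and $h$. The flow of $L$ is a $2\pi$-periodic $\mathbb{S}^1$-action. With $q_2=\arg(u+iv)-\arg(x+iy)$ and $p_2=\mu(u^2+v^2)/2$, the system reduced by this action on $L=l$ has symplectic form $dp_2\wedge dq_2$ and Hamiltonian $$H_{red}(q_2,p_2)=\sqrt{\frac{-p_2(p_2-l)(p_2-l-2\lambda)}{2\lambda^2\mu}}\,\cos(q_2),\qquad \max\{0,l\}\le p_2\le l+2\lambda,\ -\pi\le q_2\le\pi.$$ For a regular value $(l,h)$, the (non-trivial) action is $I(l,h)=\frac{1}{2\pi}\oint_{\beta_{l,h}}q_2\,dp_2$, where $\beta_{l,h}$ is the closed reduced orbit $H_{red}=h$, oriented so that $\partial I/\partial h>0$;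 it is taken to be a smooth branch of the action of the reduced orbit near the given regular value (also across $h=0$). The rotation number is $W(l,h)=-\frac{\partial I}{\partial l}(l,h)$ and the twist is $\mathcal{T}(l,h)=\frac{\partial W}{\partial l}(l,h)$, derivatives with respect to $l$ being taken at fixed $h$. The twist is defined at regular values of $F$. *)

theory Defs
  imports "HOL-Analysis.Analysis"
begin

section \<open>The coupled spin-oscillator\<close>

definition phase_space :: "((real^3) \<times> (real^2)) set" where
  "phase_space = sphere 0 1 \<times> UNIV"

definition L_ham :: "real \<Rightarrow> real \<Rightarrow> (real^3) \<times> (real^2) \<Rightarrow> real" where
  "L_ham lam mu = (\<lambda>(s, w). mu * ((w$1)\<^sup>2 + (w$2)\<^sup>2) / 2 + lam * (s$3 - 1))"

definition H_ham :: "(real^3) \<times> (real^2) \<Rightarrow> real" where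
  "H_ham = (\<lambda>(s, w). (s$1 * w$1 + s$2 * w$2) / 2)"

definition F_map :: "real \<Rightarrow> real \<Rightarrow> (real^3) \<times> (real^2) \<Rightarrow> real \<times> real" where
  "F_map lam mu m = (L_ham lam mu m, H_ham m)"

definition tangent_space :: "(real^3) \<times> (real^2) \<Rightarrow> ((real^3) \<times> (real^2)) set" where
  "tangent_space m = {(a, b). a \<bullet> fst m = 0}"

text \<open>The formula for \<open>F\<close> makes sense on all of \<open>\<real>\<^sup>3 \<times> \<real>\<^sup>2\<close>; the differential of its
  restriction to the phase space is the ambient derivative restricted to the tangent space.\<close>

definition regular_value :: "real \<Rightarrow> real \<Rightarrow> real \<times> real \<Rightarrow> bool" where
  "regular_value lam mu c \<longleftrightarrow>
     (\<forall>m\<in>phase_space. F_map lam mu m = c \<longrightarrow>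
        frechet_derivative (F_map lam mu) (at m) ` tangent_space m = UNIV)"

definition regular_values_in_image :: "real \<Rightarrow> real \<Rightarrow> (real \<times> real) set" where
  "regular_values_in_image lam mu =
     {c \<in> F_map lam mu ` phase_space. regular_value lam mu c}"

section \<open>The reduced system\<close>

text \<open>Points of the reduced space are pairs \<open>(q\<^sub>2, p\<^sub>2)\<close>, where \<open>q\<^sub>2\<close> is an angle: \<open>-pi\<close> and \<open>pi\<close>
  are identified. Each of the two boundary circles of this cylinder represents a single
  point of the reduced space (a pole of a sphere, for regular \<open>l\<close>).\<close>

definition reduced_space :: "real \<Rightarrow> real \<Rightarrow> (real \<times> real) set" where
  "reduced_space lam l = {-pi..pi} \<times> {max 0 l..l + 2 * lam}"

definition H_red :: "real \<Rightarrow> real \<Rightarrow> real \<Rightarrow> real \<times> real \<Rightarrow> real" where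
  "H_red lam mu l = (\<lambda>(q, p).
     sqrt (- p * (p - l) * (p - l - 2 * lam) / (2 * lam\<^sup>2 * mu)) * cos q)"

definition reduced_orbit :: "real \<Rightarrow> real \<Rightarrow> real \<times> real \<Rightarrow> (real \<times> real) set" where
  "reduced_orbit lam mu = (\<lambda>(l, h). {x \<in> reduced_space lam l. H_red lam mu l x = h})"

definition angle_lift :: "(real \<times> real) set \<Rightarrow> (real \<times> real) set" where
  "angle_lift S = {(q + 2 * pi * of_int k, p) | q p k. (q, p) \<in> S}"

text \<open>For \<open>h \<noteq> 0\<close> the orbit \<open>H_red = h\<close> avoids both poles. It is traversed once by a closed
  curve, in either direction, along which \<open>q\<^sub>2\<close> is chosen continuously. For \<open>h < 0\<close> such a
  curve leaves the strip \<open>-pi \<le> q\<^sub>2 \<le> pi\<close>, whence the lift.\<close>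

definition traverses_orbit ::
    "real \<Rightarrow> real \<Rightarrow> real \<times> real \<Rightarrow> (real \<Rightarrow> real \<times> real) \<Rightarrow> bool" where
  "traverses_orbit lam mu c \<gamma> \<longleftrightarrow>
     valid_path \<gamma> \<and> simple_path \<gamma> \<and> pathfinish \<gamma> = pathstart \<gamma> \<and>
     path_image \<gamma> \<subseteq> angle_lift (reduced_orbit lam mu c) \<and>
     reduced_orbit lam mu c \<subseteq> angle_lift (path_image \<gamma>)"

definition loop_integral :: "(real \<Rightarrow> real \<times> real) \<Rightarrow> real" where
  "loop_integral \<gamma> = integral {0..1} (\<lambda>t. fst (\<gamma> t) * snd (vector_derivative \<gamma> (at t)))"

text \<open>On the compact reduced space the loop integral of \<open>q\<^sub>2 dp\<^sub>2\<close> is a symplectic area, hence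
  defined only up to integer multiples of the total area: passing from one side of the
  orbit to the other changes it by that amount.\<close>

definition action_values :: "real \<Rightarrow> real \<Rightarrow> real \<times> real \<Rightarrow> real set" where
  "action_values lam mu c =
     {(loop_integral \<gamma> + of_int k * measure lborel (reduced_space lam (fst c))) / (2 * pi) | \<gamma> k.
        traverses_orbit lam mu c \<gamma>}"

section \<open>Smooth branches of the action, rotation number and twist\<close>

fun Ck_on :: "nat \<Rightarrow> (real \<times> real) set \<Rightarrow> (real \<times> real \<Rightarrow> real) \<Rightarrow> bool" where
  "Ck_on 0 U f \<longleftrightarrow> continuous_on U f"
| "Ck_on (Suc k) U f \<longleftrightarrow>
     (\<forall>x\<in>U. f differentiable (at x)) \<and>
     (\<forall>v. Ck_on k U (\<lambda>x. frechet_derivative f (at x) v))"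

definition smooth_function_on :: "(real \<times> real) set \<Rightarrow> (real \<times> real \<Rightarrow> real) \<Rightarrow> bool" where
  "smooth_function_on U f \<longleftrightarrow> (\<forall>k. Ck_on k U f)"

text \<open>The orbits with \<open>h = 0\<close> run through the poles, where \<open>q\<^sub>2\<close> is undefined; there the
  action is determined by smooth continuation from \<open>h \<noteq> 0\<close>. The condition on the
  derivative fixes the orientation of the orbits.\<close>

definition smooth_action_branch ::
    "real \<Rightarrow> real \<Rightarrow> real \<times> real \<Rightarrow> (real \<times> real \<Rightarrow> real) \<Rightarrow> bool" where
  "smooth_action_branch lam mu c act \<longleftrightarrow>
     (\<exists>U. open U \<and> c \<in> U \<and> U \<subseteq> regular_values_in_image lam mu \<and>
        smooth_function_on U act \<and>
        (\<forall>(l, h)\<in>U. deriv (\<lambda>h'. act (l, h')) h > 0) \<and>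
        (\<forall>(l, h)\<in>U. h \<noteq> 0 \<longrightarrow> act (l, h) \<in> action_values lam mu (l, h)))"

definition rotation_number :: "(real \<times> real \<Rightarrow> real) \<Rightarrow> real \<Rightarrow> real \<Rightarrow> real" where
  "rotation_number act l h = - deriv (\<lambda>l'. act (l', h)) l"

definition twist :: "(real \<times> real \<Rightarrow> real) \<Rightarrow> real \<Rightarrow> real \<Rightarrow> real" where
  "twist act l h = deriv (\<lambda>l'. rotation_number act l' h) l"

end

theory Submission
  imports Defs
begin

text \<open>Write \<open>[a, b] = [max 0 l, l + 2 * lam]\<close>. For small \<open>h > 0\<close> the orbit \<open>H_red = h\<close> is an oval
  \<open>\<bar>q\<bar> = arccos (h / f p)\<close>, and its loop integral is \<open>\<plusminus>2 \<integral> arccos (h / f p) dp\<close>, which tends to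
  \<open>\<plusminus>pi * (b - a)\<close>, half of the total area, as \<open>h\<close> decreases to \<open>0\<close>. So \<open>2 * pi * act (l, 0)\<close> is
  an odd multiple of half the total area, and by continuity in \<open>l\<close> this multiple is locally
  constant. The total area is affine in \<open>l\<close> on either side of the critical value \<open>l = 0\<close>; hence
  \<open>act (l, 0)\<close> is locally affine in \<open>l\<close> and its second derivative vanishes.\<close>

section \<open>Loop integrals around ovals\<close>

text \<open>Along such an arc \<open>q\<close> is a function of \<open>p\<close>, so
  \<open>q dp\<close> has the antiderivative
  \<open>c * p + \<sigma> * integral {m..p} \<phi>\<close>. The derivative of this integral is taken
  at \<open>p\<close> strictly between \<open>m\<close> and \<open>n\<close>; hence the tips
  \<open>m\<close> and \<open>n\<close> may be met only at the ends of the arc. The finitely many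
  break points of \<open>\<gamma>\<close> are harmless by continuity.\<close>

lemma loop_piece_has_integral:
  fixes \<gamma> :: "real \<Rightarrow> real \<times> real"
  assumes "valid_path \<gamma>" "0 \<le> s" "s \<le> t" "t \<le> 1"
    and cont: "continuous_on {m..n} \<phi>"
    and graph: "\<And>x. x \<in> {s..t} \<Longrightarrow> fst (\<gamma> x) = c + \<sigma> * \<phi> (snd (\<gamma> x)) \<and> snd (\<gamma> x) \<in> {m..n}"
    and inner: "\<And>x. x \<in> {s<..<t} \<Longrightarrow> snd (\<gamma> x) \<in> {m<..<n}"
  shows "((\<lambda>x. fst (\<gamma> x) * snd (vector_derivative \<gamma> (at x))) has_integral
     c * (snd (\<gamma> t) - snd (\<gamma> s)) +
     \<sigma> * (integral {m..snd (\<gamma> t)} \<phi> - integral {m..snd (\<gamma> s)} \<phi>)) {s..t}"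
proof -
  define \<Phi> where "\<Phi> x = integral {m..x} \<phi>" for x
  define G where "G x = c * snd (\<gamma> x) + \<sigma> * \<Phi> (snd (\<gamma> x))" for x
  obtain S where S: "finite S" "\<gamma> C1_differentiable_on {0..1} - S"
    using assms(1) unfolding valid_path_def piecewise_C1_differentiable_on_def by blast
  have contg: "continuous_on {0..1} \<gamma>"
    using assms(1) valid_path_imp_path path_def by blast
  have contg': "continuous_on {s..t} (\<lambda>x. snd (\<gamma> x))"
    by (intro continuous_on_snd continuous_on_subset[OF contg]) (use assms in auto)
  have contPhi: "continuous_on {m..n} \<Phi>"
    unfolding \<Phi>_def using indefinite_integral_continuous_1 integrable_continuous_real[OF cont] by blast
  have "continuous_on {s..t} G"
    unfolding G_def
    by (intro continuous_intros contg' continuous_on_compose2[OF contPhi contg']) (use graph in auto)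
  moreover have "(G has_vector_derivative fst (\<gamma> x) * snd (vector_derivative \<gamma> (at x))) (at x)"
    if x: "x \<in> {s<..<t} - S" for x
  proof -
    have "\<gamma> differentiable (at x)"
      using S(2) x assms by (auto simp: C1_differentiable_on_eq)
    then have "(\<gamma> has_vector_derivative vector_derivative \<gamma> (at x)) (at x)"
      by (simp add: vector_derivative_works)
    then have d: "((\<lambda>x. snd (\<gamma> x)) has_real_derivative snd (vector_derivative \<gamma> (at x))) (at x)"
      unfolding has_real_derivative_iff_has_vector_derivative
      by (rule bounded_linear.has_vector_derivative[OF bounded_linear_snd])
    have i: "snd (\<gamma> x) \<in> {m<..<n}" using inner x by auto
    have "(\<Phi> has_real_derivative \<phi> (snd (\<gamma> x))) (at (snd (\<gamma> x)) within {m..n})"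
      unfolding \<Phi>_def using i cont
      by (intro integral_has_real_derivative) auto
    then have "(\<Phi> has_real_derivative \<phi> (snd (\<gamma> x))) (at (snd (\<gamma> x)))"
      using i by (metis at_within_interior interior_atLeastAtMost_real)
    from DERIV_chain2[OF this d]
    have "(G has_real_derivative c * snd (vector_derivative \<gamma> (at x))
       + \<sigma> * (\<phi> (snd (\<gamma> x)) * snd (vector_derivative \<gamma> (at x)))) (at x)"
      unfolding G_def using d by (intro DERIV_add DERIV_cmult)
    moreover have "fst (\<gamma> x) = c + \<sigma> * \<phi> (snd (\<gamma> x))" using graph x by auto
    ultimately show ?thesis
      by (simp add: has_real_derivative_iff_has_vector_derivative algebra_simps)
  qed
  ultimately have "((\<lambda>x. fst (\<gamma> x) * snd (vector_derivative \<gamma> (at x))) has_integral G t - G s) {s..t}"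
    by (intro fundamental_theorem_of_calculus_interior_strong[OF S(1) \<open>s \<le> t\<close>])
  then show ?thesis by (simp add: G_def \<Phi>_def algebra_simps)
qed

text \<open>By the intermediate value theorem. Applied to \<open>q - c\<close>, it keeps a loop on
  one side of its oval between visits to the tips.\<close>

lemma constant_sign:
  fixes w :: "real \<Rightarrow> real"
  assumes "continuous_on S w" "connected S" "\<And>x. x \<in> S \<Longrightarrow> w x \<noteq> 0"
  shows "\<exists>\<sigma>\<in>{1, -1}. \<forall>x\<in>S. w x = \<sigma> * \<bar>w x\<bar>"
proof -
  have c: "connected (w ` S)" using assms connected_continuous_image by blast
  have "\<not> (w x < 0 \<and> 0 < w y)" if "x \<in> S" "y \<in> S" for x y
    using connectedD_interval[OF c, of "w x" "w y" 0] assms(3) that by fastforce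
  then have "(\<forall>x\<in>S. 0 < w x) \<or> (\<forall>x\<in>S. w x < 0)"
    using assms(3) by (meson linorder_neqE_linordered_idom)
  then show ?thesis
    by (auto simp: abs_if)
qed

text \<open>The loop passes through each tip of the oval exactly once. This cuts it into two arcs, along
  which \<open>q - c\<close> is \<open>\<phi>\<close> and \<open>- \<phi>\<close>, so that \<open>q dp\<close> has an antiderivative on each.\<close>

lemma loop_integral_oval:
  fixes \<gamma> :: "real \<Rightarrow> real \<times> real"
  assumes val: "valid_path \<gamma>" and simple: "simple_path \<gamma>"
    and closed: "pathfinish \<gamma> = pathstart \<gamma>"
    and "m < n" and cont: "continuous_on {m..n} \<phi>"
    and tips: "\<phi> m = 0" "\<phi> n = 0" and pos: "\<And>p. p \<in> {m<..<n} \<Longrightarrow> \<phi> p > 0"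
    and image: "path_image \<gamma> = {(q, p). p \<in> {m..n} \<and> \<bar>q - c\<bar> = \<phi> p}"
  shows "\<bar>loop_integral \<gamma>\<bar> = 2 * integral {m..n} \<phi>"
proof -
  have contg: "continuous_on {0..1} \<gamma>"
    using val valid_path_imp_path path_def by blast
  define w where "w x = fst (\<gamma> x) - c" for x
  have contw: "continuous_on {0..1} w"
    unfolding w_def by (intro continuous_intros contg)
  have on: "snd (\<gamma> x) \<in> {m..n}" "\<bar>w x\<bar> = \<phi> (snd (\<gamma> x))" if "x \<in> {0..1}" for x
  proof -
    have "\<gamma> x \<in> path_image \<gamma>" using that by (auto simp: path_image_def)
    then show "snd (\<gamma> x) \<in> {m..n}" "\<bar>w x\<bar> = \<phi> (snd (\<gamma> x))"
      by (auto simp: image w_def case_prod_unfold)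
  qed
  have ends: "\<gamma> 0 = \<gamma> 1" using closed by (simp add: pathfinish_def pathstart_def)
  \<comment> \<open>Time 1 only repeats the base point, so every point of the loop is reached before
    it.\<close>
  have param: "\<exists>x\<in>{0..<1}. \<gamma> x = z" if "z \<in> path_image \<gamma>" for z
  proof -
    obtain x where x: "x \<in> {0..1}" "\<gamma> x = z" using \<open>z \<in> path_image \<gamma>\<close>
      by (auto simp: path_image_def)
    show ?thesis
      by (cases "x = 1") (use x ends in auto)
  qed
  have inj: "x = y \<or> {x, y} = {0, 1}" if "x \<in> {0..1}" "y \<in> {0..1}" "\<gamma> x = \<gamma> y" for x y
    using simple that unfolding simple_path_def loop_free_def by (metis insert_commute)
  obtain t1 where t1: "t1 \<in> {0..<1}" "\<gamma> t1 = (c, m)"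
    using param[of "(c, m)"] image tips \<open>m < n\<close> by auto
  obtain t2 where t2: "t2 \<in> {0..<1}" "\<gamma> t2 = (c, n)"
    using param[of "(c, n)"] image tips \<open>m < n\<close> by auto
  \<comment> \<open>\<open>u\<close> and \<open>v\<close> are the times of the two tips in
    increasing order. Which tip comes first only affects the sign of the loop integral.\<close>
  obtain u v where uv: "0 \<le> u" "u < v" "v < 1" "{u, v} = {t1, t2}"
  proof (cases "t1 < t2")
    case True then show ?thesis using t1 t2 that[of t1 t2] by auto
  next
    case False
    have "t1 \<noteq> t2" using t1 t2 \<open>m < n\<close> by auto
    then show ?thesis using False t1 t2 that[of t2 t1] by auto
  qed
  \<comment> \<open>If \<open>u = 0\<close>, the base point is itself a tip and is visited again at
    time 1, so that time has to be excluded as well.\<close>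
  have nz: "w x \<noteq> 0 \<and> snd (\<gamma> x) \<in> {m<..<n}" if "x \<in> {0..1}" "x \<noteq> u" "x \<noteq> v" "u = 0 \<longrightarrow> x \<noteq> 1" for x
  proof -
    have "\<gamma> x \<noteq> (c, m)" "\<gamma> x \<noteq> (c, n)"
      using inj[of x t1] inj[of x t2] t1 t2 that uv by (auto simp: doubleton_eq_iff)
    moreover have "snd (\<gamma> x) \<in> {m<..<n}" if "snd (\<gamma> x) \<noteq> m" "snd (\<gamma> x) \<noteq> n"
      using on(1)[OF \<open>x \<in> {0..1}\<close>] that by auto
    moreover have "w x = 0" if "snd (\<gamma> x) = m \<or> snd (\<gamma> x) = n"
      using on(2)[OF \<open>x \<in> {0..1}\<close>] that tips by auto
    moreover have "\<phi> (snd (\<gamma> x)) = 0" if "w x = 0" using on(2)[OF \<open>x \<in> {0..1}\<close>] that by auto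
    ultimately show ?thesis
      using pos[of "snd (\<gamma> x)"] by (metis eq_iff_diff_eq_0 less_irrefl prod.collapse w_def)
  qed
  have wu: "w u = 0" "w v = 0" using uv t1 t2 by (auto simp: w_def doubleton_eq_iff)
  have sgn: "\<exists>\<sigma>\<in>{1, -1}. \<forall>x\<in>S. w x = \<sigma> * \<bar>w x\<bar>"
    if "connected S" "S \<subseteq> {0..1}" "u \<notin> S" "v \<notin> S" "u = 0 \<longrightarrow> 1 \<notin> S" for S
    using that nz by (intro constant_sign continuous_on_subset[OF contw]) blast+
  obtain \<sigma> where \<sigma>: "\<sigma> \<in> {1, -1}" "\<And>x. x \<in> {u<..<v} \<Longrightarrow> w x = \<sigma> * \<bar>w x\<bar>"
    using sgn[of "{u<..<v}"] uv by force
  \<comment> \<open>The second arc leads from \<open>v\<close> through the base point to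
    \<open>u\<close>. If the base point is not a tip, the signs on its two halves agree because
    \<open>w 0 = w 1\<close> is nonzero.\<close>
  obtain \<tau> where \<tau>: "\<tau> \<in> {1, -1}" "\<And>x. x \<in> {v..1} \<union> {0..u} \<Longrightarrow> w x = \<tau> * \<bar>w x\<bar>"
  proof (cases "u = 0")
    case True
    obtain \<tau> where \<tau>: "\<tau> \<in> {1, -1}" "\<And>x. x \<in> {v<..<1} \<Longrightarrow> w x = \<tau> * \<bar>w x\<bar>"
      using sgn[of "{v<..<1}"] uv True by force
    have "w 1 = 0" using True wu ends by (auto simp: w_def)
    then have "w x = \<tau> * \<bar>w x\<bar>" if "x \<in> {v..1} \<union> {0..u}" for x
      using \<tau>(2)[of x] True wu that by (cases "x = v \<or> x = 1 \<or> x = 0") auto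
    then show ?thesis using that \<tau>(1) by blast
  next
    case False
    obtain \<tau> where \<tau>: "\<tau> \<in> {1, -1}" "\<And>x. x \<in> {v<..1} \<Longrightarrow> w x = \<tau> * \<bar>w x\<bar>"
      using sgn[of "{v<..1}"] uv False by force
    obtain \<tau>' where \<tau>': "\<tau>' \<in> {1, -1}" "\<And>x. x \<in> {0..<u} \<Longrightarrow> w x = \<tau>' * \<bar>w x\<bar>"
      using sgn[of "{0..<u}"] uv False by force
    have "w 0 = w 1" using ends by (simp add: w_def)
    moreover have "w 1 \<noteq> 0" using nz[of 1] uv False by auto
    moreover have "w 1 = \<tau> * \<bar>w 1\<bar>" "w 0 = \<tau>' * \<bar>w 0\<bar>"
      using \<tau>(2)[of 1] \<tau>'(2)[of 0] uv False by auto
    ultimately have "\<tau> = \<tau>'" by (metis abs_0_eq mult_cancel_right)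
    then have "w x = \<tau> * \<bar>w x\<bar>" if "x \<in> {v..1} \<union> {0..u}" for x
      using \<tau>(2)[of x] \<tau>'(2)[of x] wu that by (cases "x = v \<or> x = u") auto
    then show ?thesis using that \<tau>(1) by blast
  qed
  have \<sigma>': "w x = \<sigma> * \<bar>w x\<bar>" if "x \<in> {u..v}" for x
    using \<sigma>(2)[of x] wu that by (cases "x = u \<or> x = v") auto
  \<comment> \<open>With equal signs the loop would stay on one side and miss the point at height
    \<open>r\<close> on the other side.\<close>
  have "\<sigma> \<noteq> \<tau>"
  proof
    assume "\<sigma> = \<tau>"
    define r where "r = (m + n) / 2"
    have r: "r \<in> {m<..<n}" using \<open>m < n\<close> by (auto simp: r_def)
    then have "(c - \<sigma> * \<phi> r, r) \<in> path_image \<gamma>"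
      using pos[OF r] \<sigma>(1) by (auto simp: image)
    then obtain x where x: "x \<in> {0..<1}" "\<gamma> x = (c - \<sigma> * \<phi> r, r)"
      using param by blast
    have "w x = \<sigma> * \<bar>w x\<bar>"
      using \<sigma>'[of x] \<tau>(2)[of x] \<open>\<sigma> = \<tau>\<close> x by (cases "x \<in> {u..v}") auto
    then show False using x pos[OF r] \<sigma>(1) by (auto simp: w_def)
  qed
  define \<Phi> where "\<Phi> x = integral {m..snd (\<gamma> x)} \<phi>" for x
  let ?f = "\<lambda>x. fst (\<gamma> x) * snd (vector_derivative \<gamma> (at x))"
  have piece: "(?f has_integral c * (snd (\<gamma> t) - snd (\<gamma> s)) + \<rho> * (\<Phi> t - \<Phi> s)) {s..t}"
    if st: "0 \<le> s" "s \<le> t" "t \<le> 1" and \<rho>: "\<And>x. x \<in> {s..t} \<Longrightarrow> w x = \<rho> * \<bar>w x\<bar>"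
      and out: "u \<notin> {s<..<t}" "v \<notin> {s<..<t}" for s t \<rho>
    unfolding \<Phi>_def
  proof (rule loop_piece_has_integral[OF val st cont])
    show "fst (\<gamma> x) = c + \<rho> * \<phi> (snd (\<gamma> x)) \<and> snd (\<gamma> x) \<in> {m..n}" if "x \<in> {s..t}" for x
      using on[of x] \<rho>[OF that] that st by (auto simp: w_def)
    show "snd (\<gamma> x) \<in> {m<..<n}" if "x \<in> {s<..<t}" for x
      using nz[of x] that st out by auto
  qed
  \<comment> \<open>The terms with \<open>c\<close> telescope to 0 around the closed loop. Since
    \<open>\<Phi> 0 = \<Phi> 1\<close>, the rest adds up to
    \<open>(\<sigma> - \<tau>) * (\<Phi> v - \<Phi> u)\<close> with \<open>\<sigma> - \<tau>\<close>
    equal to 2 or -2.\<close>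
  have "(?f has_integral (c * (snd (\<gamma> u) - snd (\<gamma> 0)) + \<tau> * (\<Phi> u - \<Phi> 0))
      + (c * (snd (\<gamma> v) - snd (\<gamma> u)) + \<sigma> * (\<Phi> v - \<Phi> u))
      + (c * (snd (\<gamma> 1) - snd (\<gamma> v)) + \<tau> * (\<Phi> 1 - \<Phi> v))) {0..1}"
    using uv \<tau>(2) \<sigma>'
    by (intro has_integral_combine[where c=v and a=0 and b=1]
        has_integral_combine[where c=u and a=0 and b=v] piece) auto
  moreover have "\<Phi> 0 = \<Phi> 1" using ends by (simp add: \<Phi>_def)
  ultimately have "loop_integral \<gamma> = (\<sigma> - \<tau>) * (\<Phi> v - \<Phi> u)"
    using ends unfolding loop_integral_def by (simp add: integral_unique algebra_simps)
  moreover have "\<Phi> t1 = 0" "\<Phi> t2 = integral {m..n} \<phi>"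
    using t1 t2 by (auto simp: \<Phi>_def)
  moreover have "integral {m..n} \<phi> \<ge> 0"
    using integrable_continuous_real[OF cont] tips pos
    by (intro integral_nonneg) (force simp: less_eq_real_def)+
  ultimately show ?thesis
    using uv(4) \<open>\<sigma> \<noteq> \<tau>\<close> \<sigma>(1) \<tau>(1) by (auto simp: doubleton_eq_iff abs_if)
qed

section \<open>The reduced orbits\<close>

definition amplitude :: "real \<Rightarrow> real \<Rightarrow> real \<Rightarrow> real \<Rightarrow> real" where
  "amplitude lam mu l p = sqrt (- p * (p - l) * (p - l - 2 * lam) / (2 * lam\<^sup>2 * mu))"

text \<open>The maximum with \<open>h\<close> keeps the quotient in the domain of
  \<open>arccos\<close> when \<open>h > 0\<close> and makes the half-width 0 where the amplitude is
  at most \<open>h\<close>. Integrals over the oval thus become integrals over an interval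
  independent of \<open>h\<close>.\<close>

definition half_width :: "real \<Rightarrow> real \<Rightarrow> real \<Rightarrow> real \<Rightarrow> real \<Rightarrow> real" where
  "half_width lam mu l h p = arccos (h / max h (amplitude lam mu l p))"

lemma H_red_amplitude: "H_red lam mu l (q, p) = amplitude lam mu l p * cos q"
  by (simp add: H_red_def amplitude_def)

lemma continuous_amplitude [continuous_intros]:
  "continuous_on S (amplitude lam mu l)"
  unfolding amplitude_def divide_inverse by (intro continuous_intros)

lemma amplitude_ends:
  "amplitude lam mu l (max 0 l) = 0" "amplitude lam mu l (l + 2 * lam) = 0"
  by (auto simp: amplitude_def max_def)

lemma amplitude_nonneg:
  assumes "mu > 0" "p \<in> {max 0 l..l + 2 * lam}"
  shows "amplitude lam mu l p \<ge> 0"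
proof -
  have "p * (p - l) * (l + 2 * lam - p) \<ge> 0" using assms(2) by (intro mult_nonneg_nonneg) auto
  then have "- p * (p - l) * (p - l - 2 * lam) \<ge> 0" by (simp add: algebra_simps)
  then have "- p * (p - l) * (p - l - 2 * lam) / (2 * lam\<^sup>2 * mu) \<ge> 0" using assms
    by (intro divide_nonneg_nonneg) auto
  then show ?thesis by (simp add: amplitude_def)
qed

lemma amplitude_pos:
  assumes "lam > 0" "mu > 0" "p \<in> {max 0 l<..<l + 2 * lam}"
  shows "amplitude lam mu l p > 0"
proof -
  have "p * (p - l) * (l + 2 * lam - p) > 0" using assms(3) by (intro mult_pos_pos) auto
  then have "- p * (p - l) * (p - l - 2 * lam) > 0" by (simp add: algebra_simps)
  then have "- p * (p - l) * (p - l - 2 * lam) / (2 * lam\<^sup>2 * mu) > 0" using assms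
    by (intro divide_pos_pos) auto
  then show ?thesis by (simp add: amplitude_def)
qed

text \<open>The third root of the cubic \<open>amplitude\<^sup>2 = h\<^sup>2\<close> lies to the left of \<open>max 0 l\<close>.\<close>

lemma amplitude_superlevel:
  assumes "lam > 0" "mu > 0" "- 2 * lam < l" "h > 0"
    and below: "h < amplitude lam mu l ((max 0 l + (l + 2 * lam)) / 2)"
  obtains m n where "max 0 l < m" "m < n" "n < l + 2 * lam"
    "\<And>p. p \<in> {max 0 l..l + 2 * lam} \<Longrightarrow> h \<le> amplitude lam mu l p \<longleftrightarrow> p \<in> {m..n}"
    "\<And>p. p \<in> {max 0 l..l + 2 * lam} \<Longrightarrow> h < amplitude lam mu l p \<longleftrightarrow> p \<in> {m<..<n}"
proof -
  define a b where "a = max 0 l" and "b = l + 2 * lam"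
  let ?f = "amplitude lam mu l"
  define r where "r = (a + b) / 2"
  have ab: "a < b" using assms by (auto simp: a_def b_def)
  have r: "a < r" "r < b" using ab by (auto simp: r_def)
  have fa: "?f a = 0" "?f b = 0" using amplitude_ends by (auto simp: a_def b_def)
  have fr: "h < ?f r" using below by (simp add: r_def a_def b_def)
  \<comment> \<open>The amplitude vanishes at both ends and exceeds \<open>h\<close> at the midpoint
    \<open>r\<close>, so the level \<open>h\<close> is attained on either side of
    \<open>r\<close>.\<close>
  obtain m where m: "a \<le> m" "m \<le> r" "?f m = h"
    using IVT'[of ?f a h r] fa fr \<open>h > 0\<close> r continuous_amplitude by (metis less_imp_le)
  obtain n where n: "r \<le> n" "n \<le> b" "?f n = h"
    using IVT2'[of ?f b h r] fa fr \<open>h > 0\<close> r continuous_amplitude by (metis less_imp_le)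
  have strict: "a < m" "m < r" "r < n" "n < b"
    using m n fa fr \<open>h > 0\<close> by (auto simp: less_le)
  define c where "c p = - p * (p - l) * (p - l - 2 * lam)" for p
  define K where "K = 2 * lam\<^sup>2 * mu"
  have "K > 0" using assms by (simp add: K_def)
  have f: "?f p = sqrt (c p / K)" for p by (simp add: amplitude_def c_def K_def)
  have le: "h \<le> ?f p \<longleftrightarrow> c p - K * h\<^sup>2 \<ge> 0" for p
  proof -
    have "h \<le> ?f p \<longleftrightarrow> h\<^sup>2 \<le> c p / K"
      unfolding f using \<open>h > 0\<close> real_le_rsqrt sqrt_ge_absD[of h] by auto
    then show ?thesis using \<open>K > 0\<close> by (simp add: field_simps)
  qed
  have lt: "h < ?f p \<longleftrightarrow> c p - K * h\<^sup>2 > 0" for p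
  proof -
    have "h < ?f p \<longleftrightarrow> h\<^sup>2 < c p / K"
      unfolding f using \<open>h > 0\<close> real_sqrt_less_iff[of "h\<^sup>2" "c p / K"] by simp
    then show ?thesis using \<open>K > 0\<close> by (simp add: field_simps)
  qed
  have cm: "c m = K * h\<^sup>2" "c n = K * h\<^sup>2"
    using le[of m] lt[of m] le[of n] lt[of n] m n by auto
  \<comment> \<open>Vieta: the roots of the cubic \<open>c p - K * h\<^sup>2\<close> add up to
    \<open>2 * l + 2 * lam\<close>, and \<open>m\<close> and \<open>n\<close> are two of
    them.\<close>
  define s where "s = 2 * l + 2 * lam - m - n"
  have fac: "c p - K * h\<^sup>2 = (p - m) * (n - p) * (p - s)" for p
  proof -
    have "(m - n) * (m^2 + m * n + n^2 - (2 * l + 2 * lam) * (m + n) + l * (l + 2 * lam)) = c n - c m"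
      unfolding c_def by algebra
    then have "l * (l + 2 * lam) = (2 * l + 2 * lam) * (m + n) - (m^2 + m * n + n^2)"
      using cm strict by auto
    then have "c p - c m = (p - m) * (n - p) * (p - s)" unfolding c_def s_def by algebra
    then show ?thesis using cm by simp
  qed
  \<comment> \<open>Evaluating the factorization at \<open>a\<close>, where \<open>c\<close>
    vanishes, gives a product whose sign forces \<open>s < a\<close>. Hence \<open>p - s\<close>
    does not affect signs on \<open>[a, b]\<close>.\<close>
  have "c a = 0" using c_def a_def by (auto simp: max_def)
  then have "(m - a) * (n - a) * (a - s) = K * h\<^sup>2" using fac[of a] by (simp add: algebra_simps)
  moreover have "K * h\<^sup>2 > 0" using \<open>K > 0\<close> \<open>h > 0\<close> by simp
  moreover have "(m - a) * (n - a) > 0" using strict by (intro mult_pos_pos) auto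
  ultimately have "a - s > 0" by (metis zero_less_mult_pos)
  then have s: "p - s > 0" if "p \<in> {a..b}" for p using that by auto
  show ?thesis
  proof (rule that[of m n])
    fix p assume "p \<in> {max 0 l..l + 2 * lam}"
    then have p: "p \<in> {a..b}" by (auto simp: a_def b_def)
    have "h \<le> ?f p \<longleftrightarrow> 0 \<le> (p - m) * (n - p)"
      unfolding le fac using s[OF p] by (simp add: zero_le_mult_iff)
    then show "h \<le> ?f p \<longleftrightarrow> p \<in> {m..n}"
      using strict by (auto simp: zero_le_mult_iff)
    have "h < ?f p \<longleftrightarrow> 0 < (p - m) * (n - p)"
      unfolding lt fac using s[OF p] by (simp add: zero_less_mult_iff)
    then show "h < ?f p \<longleftrightarrow> p \<in> {m<..<n}"
      using strict by (auto simp: zero_less_mult_iff)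
  qed (use strict in \<open>auto simp: a_def b_def\<close>)
qed

section \<open>The half-width of the oval as a function of \<open>p\<close>\<close>

lemma half_width_arg:
  fixes h x :: real
  assumes "h > 0"
  shows "0 < h / max h x" "h / max h x \<le> 1"
  using assms by (auto simp: max_def)

lemma continuous_half_width:
  assumes "h > 0"
  shows "continuous_on S (half_width lam mu l h)"
proof -
  have "- 1 \<le> h / max h x" for x
    using half_width_arg(1)[OF assms, of x] by linarith
  then show ?thesis
    unfolding half_width_def[abs_def] using assms half_width_arg(2)[OF assms]
    by (intro continuous_intros ballI conjI) (auto simp: max_def)
qed

text \<open>The strict bound \<open>pi / 2\<close> confines the oval to a strip where
  \<open>cos q > 0\<close>, so that its translates by multiples of \<open>2 * pi\<close> are
  separated.\<close>

lemma half_width_bounds: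
  assumes "h > 0"
  shows "0 \<le> half_width lam mu l h p" "half_width lam mu l h p < pi / 2"
proof -
  let ?x = "h / max h (amplitude lam mu l p)"
  have x: "0 < ?x" "?x \<le> 1" using half_width_arg[OF assms] by auto
  then show "0 \<le> half_width lam mu l h p" by (auto simp: half_width_def intro!: arccos_lbound)
  have "arccos ?x < arccos 0" using x by (intro arccos_less_arccos) auto
  then show "half_width lam mu l h p < pi / 2" by (simp add: half_width_def)
qed

lemma half_width_eq_0: "h > 0 \<Longrightarrow> amplitude lam mu l p \<le> h \<Longrightarrow> half_width lam mu l h p = 0"
  by (simp add: half_width_def max_def)

lemma half_width_pos:
  assumes "h > 0" "h < amplitude lam mu l p"
  shows "half_width lam mu l h p > 0"
proof -
  let ?x = "h / amplitude lam mu l p"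
  have "0 < ?x" "?x < 1" using assms by auto
  then have "arccos ?x > arccos 1"
    by (intro arccos_less_arccos) auto
  then show ?thesis using assms by (simp add: half_width_def max_def)
qed

text \<open>From \<open>amplitude * cos q = h > 0\<close> it follows that the amplitude is at least
  \<open>h\<close>; then \<open>cos q\<close> can be solved for, and
  \<open>\<bar>q\<bar> \<le> pi\<close> allows inverting the cosine.\<close>

lemma reduced_orbit_iff:
  assumes "mu > 0" "h > 0"
  shows "(q, p) \<in> reduced_orbit lam mu (l, h) \<longleftrightarrow>
    p \<in> {max 0 l..l + 2 * lam} \<and> h \<le> amplitude lam mu l p \<and> \<bar>q\<bar> = half_width lam mu l h p"
    (is "?lhs \<longleftrightarrow> ?rhs")
proof
  let ?f = "amplitude lam mu l p"
  assume ?lhs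
  then have q: "\<bar>q\<bar> \<le> pi" and p: "p \<in> {max 0 l..l + 2 * lam}" and e: "?f * cos q = h"
    by (auto simp: reduced_orbit_def reduced_space_def H_red_amplitude)
  have "?f \<ge> 0" using amplitude_nonneg assms p by auto
  then have "?f * cos q \<le> ?f * 1" by (intro mult_left_mono) auto
  then have hf: "h \<le> ?f" using e by simp
  then have "cos q = h / ?f" using e assms by (simp add: field_simps)
  moreover have "arccos (cos \<bar>q\<bar>) = \<bar>q\<bar>" using q by (intro arccos_cos) auto
  ultimately have "\<bar>q\<bar> = half_width lam mu l h p"
    using hf by (simp add: half_width_def max_def)
  then show ?rhs using p hf by blast
next
  let ?f = "amplitude lam mu l p"
  assume r: ?rhs
  have w: "half_width lam mu l h p < pi / 2" using half_width_bounds assms by blast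
  have "cos q = cos \<bar>q\<bar>" by simp
  also have "\<dots> = h / max h ?f"
    using half_width_arg[OF assms(2), of ?f] r unfolding half_width_def
    by (simp add: cos_arccos del: cos_abs_real)
  also have "\<dots> = h / ?f" using r by (simp add: max_def)
  finally have "?f * cos q = h" using r assms by simp
  moreover have "\<bar>q\<bar> \<le> pi" using r w pi_gt_zero by linarith
  ultimately show ?lhs
    using r by (auto simp: reduced_orbit_def reduced_space_def H_red_amplitude)
qed

section \<open>Loops along the lifted orbit\<close>

lemma close_period:
  fixes j :: int
  assumes "\<bar>x + 2 * pi * of_int j\<bar> < pi / 2" "\<bar>x\<bar> < pi / 2"
  shows "j = 0"
proof -
  have "\<bar>2 * pi * real_of_int j\<bar> < pi" using assms by linarith
  then have "pi * (2 * \<bar>real_of_int j\<bar>) < pi * 1" by (simp add: abs_mult)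
  then have "2 * \<bar>real_of_int j\<bar> < 1" using mult_less_cancel_left_pos[OF pi_gt_zero] by blast
  then show ?thesis by linarith
qed

text \<open>The lifted orbit is a union of ovals centred at the multiples of \<open>2 * pi\<close>.
  A loop in it is connected and stays in one of them; since it covers the orbit modulo
  \<open>2 * pi\<close>, it fills this oval, and \<open>loop_integral_oval\<close> applies. Outside
  \<open>[m, n]\<close> the half-width is 0, so the integral extends to the full range of
  \<open>p\<close>.\<close>

lemma loop_integral_orbit:
  assumes "lam > 0" "mu > 0" "- 2 * lam < l" "h > 0"
    and below: "h < amplitude lam mu l ((max 0 l + (l + 2 * lam)) / 2)"
    and trav: "traverses_orbit lam mu (l, h) \<gamma>"
  shows "\<bar>loop_integral \<gamma>\<bar> = 2 * integral {max 0 l..l + 2 * lam} (half_width lam mu l h)"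
proof -
  let ?a = "max 0 l" and ?b = "l + 2 * lam"
  let ?f = "amplitude lam mu l" and ?\<phi> = "half_width lam mu l h"
  obtain m n where mn: "?a < m" "m < n" "n < ?b"
    and le: "\<And>p. p \<in> {?a..?b} \<Longrightarrow> h \<le> ?f p \<longleftrightarrow> p \<in> {m..n}"
    and lt: "\<And>p. p \<in> {?a..?b} \<Longrightarrow> h < ?f p \<longleftrightarrow> p \<in> {m<..<n}"
    using amplitude_superlevel[OF assms(1-4) below] by metis
  have orbit: "(q, p) \<in> reduced_orbit lam mu (l, h) \<longleftrightarrow> p \<in> {m..n} \<and> \<bar>q\<bar> = ?\<phi> p" for q p
    using le mn unfolding reduced_orbit_iff[OF \<open>mu > 0\<close> \<open>h > 0\<close>] by auto
  note w = half_width_bounds(2)[OF \<open>h > 0\<close>, of lam mu l]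
  have val: "valid_path \<gamma>" "simple_path \<gamma>" "pathfinish \<gamma> = pathstart \<gamma>"
    and sub: "path_image \<gamma> \<subseteq> angle_lift (reduced_orbit lam mu (l, h))"
    and sup: "reduced_orbit lam mu (l, h) \<subseteq> angle_lift (path_image \<gamma>)"
    using trav by (auto simp: traverses_orbit_def)
  have lift: "\<exists>k::int. p \<in> {m..n} \<and> \<bar>q - 2 * pi * of_int k\<bar> = ?\<phi> p"
    if "(q, p) \<in> path_image \<gamma>" for q p
  proof -
    obtain q' k where "q = q' + 2 * pi * of_int k" "(q', p) \<in> reduced_orbit lam mu (l, h)"
      using subsetD[OF sub \<open>(q, p) \<in> path_image \<gamma>\<close>] unfolding angle_lift_def by auto
    then show ?thesis unfolding orbit by (intro exI[of _ k]) auto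
  qed
  have conn: "connected (fst ` path_image \<gamma>)"
    by (intro connected_continuous_image continuous_intros connected_path_image
          valid_path_imp_path val)
  have cos_pos: "cos q > 0" if q: "q \<in> fst ` path_image \<gamma>" for q
  proof -
    obtain p k where "\<bar>q - 2 * pi * of_int k\<bar> = ?\<phi> p" using lift q by force
    then have "cos (q - 2 * pi * of_int k) > 0" using w[of p] by (intro cos_gt_zero_pi) auto
    then show ?thesis by (simp add: cos_diff)
  qed
  obtain k :: int where k: "\<bar>fst (\<gamma> 0) - 2 * pi * of_int k\<bar> < pi / 2"
  proof -
    have "(fst (\<gamma> 0), snd (\<gamma> 0)) \<in> path_image \<gamma>" by (auto simp: path_image_def)
    from lift[OF this] show ?thesis using that w by metis
  qed
  \<comment> \<open>The values of \<open>q\<close> along the loop form an interval. If they met two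
    different strips, they would include \<open>2 * pi * i + pi\<close>, where the cosine is
    -1.\<close>
  have no_jump: "\<not> i < j"
    if "\<bar>x - 2 * pi * of_int i\<bar> < pi / 2" "\<bar>y - 2 * pi * of_int j\<bar> < pi / 2"
      "x \<in> fst ` path_image \<gamma>" "y \<in> fst ` path_image \<gamma>" for x y and i j :: int
  proof
    assume "i < j"
    then have "2 * pi * (real_of_int i + 1) \<le> 2 * pi * real_of_int j"
      by (intro mult_left_mono) auto
    then have "x \<le> 2 * pi * of_int i + pi" "2 * pi * of_int i + pi \<le> y"
      using that(1,2) pi_gt_zero by (auto simp: algebra_simps abs_if split: if_splits)
    then have "2 * pi * of_int i + pi \<in> fst ` path_image \<gamma>"
      using connectedD_interval[OF conn that(3,4)] by blast
    from cos_pos[OF this] show False by (simp add: cos_add)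
  qed
  have start: "fst (\<gamma> 0) \<in> fst ` path_image \<gamma>" by (auto simp: path_image_def)
  define c where "c = 2 * pi * of_int k"
  have image: "path_image \<gamma> = {(q, p). p \<in> {m..n} \<and> \<bar>q - c\<bar> = ?\<phi> p}"
  proof (intro equalityI subrelI)
    fix q p assume qp: "(q, p) \<in> path_image \<gamma>"
    obtain k' :: int where k': "p \<in> {m..n}" "\<bar>q - 2 * pi * of_int k'\<bar> = ?\<phi> p"
      using lift[OF qp] by blast
    have "q \<in> fst ` path_image \<gamma>" using qp by force
    then have "k' = k"
      using no_jump[OF k _ start] no_jump[OF _ k _ start] k' w[of p] by (metis linorder_neqE)
    then show "(q, p) \<in> {(q, p). p \<in> {m..n} \<and> \<bar>q - c\<bar> = ?\<phi> p}"
      using k' by (simp add: c_def)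
  next
    fix q p assume "(q, p) \<in> {(q, p). p \<in> {m..n} \<and> \<bar>q - c\<bar> = ?\<phi> p}"
    then have p: "p \<in> {m..n}" and q: "\<bar>q - c\<bar> = ?\<phi> p" by auto
    then have "(q - c, p) \<in> angle_lift (path_image \<gamma>)" using sup orbit by blast
    then obtain q' j where q': "q - c = q' + 2 * pi * of_int j" "(q', p) \<in> path_image \<gamma>"
      by (auto simp: angle_lift_def)
    obtain k' :: int where k': "\<bar>q' - 2 * pi * of_int k'\<bar> = ?\<phi> p"
      using lift[OF q'(2)] by blast
    have "q' \<in> fst ` path_image \<gamma>" using q'(2) by force
    then have "k' = k"
      using no_jump[OF k _ start] no_jump[OF _ k _ start] k' w[of p] by (metis linorder_neqE)
    \<comment> \<open>Both \<open>q - c\<close> and its translate by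
      \<open>2 * pi * (- j - k)\<close> lie within \<open>pi / 2\<close> of 0, so the translation is
      trivial and the point found on the loop is \<open>(q, p)\<close> itself.\<close>
    then have "\<bar>(q - c) + 2 * pi * of_int (- j - k)\<bar> < pi / 2"
      using k' q'(1) w[of p] by (simp add: algebra_simps)
    then have "- j - k = 0" using close_period q w[of p] by metis
    then have "k = - j" by simp
    then have "q' = q" using q'(1) by (simp add: c_def)
    then show "(q, p) \<in> path_image \<gamma>" using q'(2) by simp
  qed
  have zero: "?\<phi> p = 0" if "p \<in> {?a..m} \<union> {n..?b}" for p
    using lt[of p] that mn half_width_eq_0[OF \<open>h > 0\<close>] by force
  have "\<bar>loop_integral \<gamma>\<bar> = 2 * integral {m..n} ?\<phi>"
  proof (rule loop_integral_oval[OF val \<open>m < n\<close> continuous_half_width[OF \<open>h > 0\<close>] _ _ _ image])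
    show "?\<phi> m = 0" "?\<phi> n = 0" using zero mn by auto
    show "?\<phi> p > 0" if "p \<in> {m<..<n}" for p
      using lt[of p] that mn half_width_pos[OF \<open>h > 0\<close>] by auto
  qed
  moreover have "integral {?a..?b} ?\<phi> = integral {m..n} ?\<phi>"
  proof -
    have int: "?\<phi> integrable_on {x..y}" for x y
      by (intro integrable_continuous_real continuous_half_width \<open>h > 0\<close>)
    have "integral {?a..m} ?\<phi> = integral {?a..m} (\<lambda>_. 0)"
      "integral {n..?b} ?\<phi> = integral {n..?b} (\<lambda>_. 0)"
      using zero by (intro integral_cong; simp)+
    moreover have "integral {?a..m} ?\<phi> + integral {m..?b} ?\<phi> = integral {?a..?b} ?\<phi>"
      using mn int by (intro Henstock_Kurzweil_Integration.integral_combine) auto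
    moreover have "integral {m..n} ?\<phi> + integral {n..?b} ?\<phi> = integral {m..?b} ?\<phi>"
      using mn int by (intro Henstock_Kurzweil_Integration.integral_combine) auto
    ultimately show ?thesis by simp
  qed
  ultimately show ?thesis by simp
qed

section \<open>The action near \<open>h = 0\<close>\<close>

text \<open>Dominated convergence with the bound \<open>pi / 2\<close>: in the interior the
  amplitude is positive, so the quotient tends to 0 and the half-width to
  \<open>arccos 0 = pi / 2\<close>.\<close>

lemma half_width_integral_tendsto:
  assumes "lam > 0" "mu > 0" "- 2 * lam < l"
    and pos: "\<And>i. h i > 0" and lim: "h \<longlonglongrightarrow> 0"
  shows "(\<lambda>i. integral {max 0 l..l + 2 * lam} (half_width lam mu l (h i)))
    \<longlonglongrightarrow> pi / 2 * (l + 2 * lam - max 0 l)"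
proof -
  define a b where "a = max 0 l" and "b = l + 2 * lam"
  have "a < b" using assms by (auto simp: a_def b_def)
  \<comment> \<open>At the two ends the amplitude is 0 and the half-width is
    \<open>arccos 1 = 0\<close> for every \<open>h i\<close>; these two points do not change the
    integral of the limit.\<close>
  define g where "g p = (if p = a \<or> p = b then 0 else pi / 2)" for p
  have "(\<lambda>i. half_width lam mu l (h i) p) \<longlonglongrightarrow> g p" if p: "p \<in> {a..b}" for p
  proof (cases "p = a \<or> p = b")
    case True
    then have "amplitude lam mu l p = 0"
      using amplitude_ends by (auto simp: a_def b_def)
    then have "half_width lam mu l (h i) p = 0" for i
      using half_width_eq_0 pos[of i] by simp
    then show ?thesis using True by (simp add: g_def)
  next
    case False
    define A where "A = amplitude lam mu l p"
    have "a < p" "p < b" using False p by auto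
    then have "A > 0" unfolding A_def
      using assms by (intro amplitude_pos) (simp_all add: a_def b_def)
    then have "(\<lambda>i. h i / max (h i) A) \<longlonglongrightarrow> 0 / max 0 A"
      by (intro tendsto_intros lim) auto
    then have "(\<lambda>i. arccos (h i / max (h i) A)) \<longlonglongrightarrow> arccos 0"
      by (intro isCont_tendsto_compose[OF isCont_arccos]) auto
    then show ?thesis using False by (simp add: g_def half_width_def A_def)
  qed
  moreover have "norm (half_width lam mu l (h i) p) \<le> pi / 2" for i p
    using half_width_bounds[OF pos[of i], of lam mu l p] by simp
  moreover have "half_width lam mu l (h i) integrable_on {a..b}" for i
    by (intro integrable_continuous_real continuous_half_width pos)
  ultimately have "(\<lambda>i. integral {a..b} (half_width lam mu l (h i))) \<longlonglongrightarrow> integral {a..b} g"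
    by (intro dominated_convergence(2)[where h="\<lambda>_. pi / 2"]) auto
  also have "integral {a..b} g = integral {a..b} (\<lambda>_. pi / 2)"
    by (rule integral_spike[of "{a, b}"]) (auto simp: g_def)
  finally show ?thesis using \<open>a < b\<close> by (simp add: a_def b_def mult.commute)
qed

lemma measure_reduced_space:
  assumes "lam > 0" "- 2 * lam < l"
  shows "measure lborel (reduced_space lam l) = 2 * pi * (l + 2 * lam - max 0 l)"
proof -
  have "reduced_space lam l = cbox (- pi, max 0 l) (pi, l + 2 * lam)"
    by (auto simp: reduced_space_def cbox_Pair_eq)
  then show ?thesis
    using assms by (simp add: content_Pair)
qed

text \<open>Taking cosines removes the orientation of the orbit and the multiples of the total area
  before passing to the limit \<open>h \<rightarrow> 0\<close>.\<close>

lemma cos_action_zero: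
  assumes "lam > 0" "mu > 0" "- 2 * lam < l"
    and cont: "isCont (\<lambda>h. act (l, h)) 0"
    and ev: "\<forall>\<^sub>F h in at_right 0. act (l, h) \<in> action_values lam mu (l, h)"
  shows "cos (2 * pi * act (l, 0) / (l + 2 * lam - max 0 l)) = - 1"
proof -
  define D where "D = l + 2 * lam - max 0 l"
  have "D > 0" using assms by (auto simp: D_def)
  define h where "h i = inverse (real (Suc i))" for i
  have pos: "h i > 0" for i by (simp add: h_def)
  have lim: "h \<longlonglongrightarrow> 0" unfolding h_def by (rule LIMSEQ_inverse_real_of_nat)
  have right: "filterlim h (at_right 0) sequentially"
    using pos lim pos[THEN less_imp_neq, symmetric] by (simp add: filterlim_at)
  define J where "J i = integral {max 0 l..l + 2 * lam} (half_width lam mu l (h i))" for i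
  have J: "J \<longlonglongrightarrow> pi / 2 * D"
    using half_width_integral_tendsto[OF assms(1-3) pos lim] by (simp add: J_def[abs_def] D_def)
  have "amplitude lam mu l ((max 0 l + (l + 2 * lam)) / 2) > 0"
    using assms by (intro amplitude_pos) auto
  then have "\<forall>\<^sub>F i in sequentially. h i < amplitude lam mu l ((max 0 l + (l + 2 * lam)) / 2)"
    using lim order_tendstoD(2) by blast
  moreover have "\<forall>\<^sub>F i in sequentially. act (l, h i) \<in> action_values lam mu (l, h i)"
    using filterlim_iff right ev by fast
  \<comment> \<open>Division by \<open>D\<close> turns the total area \<open>2 * pi * D\<close> into
    one period of the cosine. The limit \<open>pi * D\<close> of \<open>2 * J i\<close> becomes
    \<open>pi\<close>, whence the value -1.\<close>
  ultimately have "\<forall>\<^sub>F i in sequentially. cos (2 * pi * act (l, h i) / D) = cos (2 * J i / D)"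
  proof eventually_elim
    case (elim i)
    obtain \<gamma> k where trav: "traverses_orbit lam mu (l, h i) \<gamma>"
      and act: "act (l, h i) = (loop_integral \<gamma> + of_int k * (2 * pi * D)) / (2 * pi)"
      using elim(2) measure_reduced_space[OF assms(1,3)] by (auto simp: action_values_def D_def)
    have J: "\<bar>loop_integral \<gamma>\<bar> = 2 * J i"
      using loop_integral_orbit[OF assms(1-3) pos elim(1) trav] by (simp add: J_def)
    have "2 * pi * act (l, h i) / D = loop_integral \<gamma> / D + 2 * pi * of_int k"
      using \<open>D > 0\<close> by (simp add: act field_simps)
    then have "cos (2 * pi * act (l, h i) / D) = cos (loop_integral \<gamma> / D)"
      by (simp add: cos_add)
    also have "\<dots> = cos \<bar>loop_integral \<gamma> / D\<bar>" by (simp only: cos_abs_real)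
    also have "\<bar>loop_integral \<gamma> / D\<bar> = 2 * J i / D" using J \<open>D > 0\<close> by simp
    finally show ?case .
  qed
  moreover have "(\<lambda>i. cos (2 * J i / D)) \<longlonglongrightarrow> cos (2 * (pi / 2 * D) / D)"
    by (intro tendsto_intros J) (use \<open>D > 0\<close> in auto)
  ultimately have "(\<lambda>i. cos (2 * pi * act (l, h i) / D)) \<longlonglongrightarrow> cos pi"
    using \<open>D > 0\<close> by (simp add: tendsto_cong)
  moreover have "(\<lambda>i. act (l, h i)) \<longlonglongrightarrow> act (l, 0)"
    using isCont_tendsto_compose[OF cont lim] .
  then have "(\<lambda>i. cos (2 * pi * act (l, h i) / D)) \<longlonglongrightarrow> cos (2 * pi * act (l, 0) / D)"
    by (intro tendsto_intros) (use \<open>D > 0\<close> in auto)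
  ultimately show ?thesis
    using LIMSEQ_unique by (fastforce simp: D_def)
qed

section \<open>Constraints on \<open>l\<close> from regularity\<close>

lemma L_ham_ge:
  assumes "lam > 0" "mu > 0" "m \<in> phase_space"
  shows "L_ham lam mu m \<ge> - 2 * lam"
proof -
  obtain s w where m: "m = (s, w)" by force
  have "\<bar>s $ 3\<bar> \<le> 1" using component_le_norm_cart[of s 3] assms(3) by (simp add: m phase_space_def)
  then have "lam * (s $ 3 - 1) \<ge> lam * (- 2)" using assms by (intro mult_left_mono) auto
  moreover have "mu * ((w$1)\<^sup>2 + (w$2)\<^sup>2) / 2 \<ge> 0" using assms by auto
  ultimately show ?thesis by (simp add: L_ham_def m)
qed

text \<open>The pole \<open>z = 1\<close> with \<open>u = v = 0\<close> is a critical point of \<open>L\<close> with value \<open>(0, 0)\<close>.\<close>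

lemma not_regular_value_0: "\<not> regular_value lam mu (0, 0)"
proof
  assume reg: "regular_value lam mu (0, 0)"
  define m :: "(real^3) \<times> (real^2)" where "m = (axis 3 1, 0)"
  have comps: "fst m $ 1 = 0" "fst m $ 2 = 0" "fst m $ 3 = 1" "snd m = 0"
    by (auto simp: m_def axis_def)
  have m: "m \<in> phase_space" by (simp add: m_def phase_space_def norm_axis_1)
  have F: "F_map lam mu m = (0, 0)"
    by (simp add: F_map_def L_ham_def H_ham_def m_def axis_def)
  have eq: "F_map lam mu = (\<lambda>x. (mu * ((snd x $ 1)\<^sup>2 + (snd x $ 2)\<^sup>2) / 2 + lam * (fst x $ 3 - 1),
      (fst x $ 1 * snd x $ 1 + fst x $ 2 * snd x $ 2) / 2))"
    by (auto simp: F_map_def L_ham_def H_ham_def case_prod_unfold)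
  have "(F_map lam mu has_derivative
      (\<lambda>v. (lam * fst v $ 3,
        (fst m $ 1 * snd v $ 1 + fst v $ 1 * snd m $ 1 +
          (fst m $ 2 * snd v $ 2 + fst v $ 2 * snd m $ 2)) / 2))) (at m)"
    unfolding eq using comps
    by (auto intro!: derivative_eq_intros bounded_linear.has_derivative[OF bounded_linear_vec_nth]
        simp: algebra_simps)
  then have "frechet_derivative (F_map lam mu) (at m) =
      (\<lambda>v. (lam * fst v $ 3,
        (fst m $ 1 * snd v $ 1 + fst v $ 1 * snd m $ 1 +
          (fst m $ 2 * snd v $ 2 + fst v $ 2 * snd m $ 2)) / 2))"
    by (rule frechet_derivative_at[symmetric])
  \<comment> \<open>At the pole the \<open>L\<close>-component of the differential is
    \<open>lam\<close> times the third component of the spherical part, which is 0 on tangent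
    vectors. So \<open>(1, 0)\<close> cannot be attained.\<close>
  moreover have "(1, 0) \<in> frechet_derivative (F_map lam mu) (at m) ` tangent_space m"
    using reg m F by (auto simp: regular_value_def)
  moreover have "fst v $ 3 = 0" if "v \<in> tangent_space m" for v
    using that by (auto simp: tangent_space_def m_def inner_axis)
  ultimately show False by auto
qed

lemma open_section:
  assumes "open U"
  shows "open {x. (x, y) \<in> U}"
proof -
  have "continuous_on UNIV (\<lambda>x. (x, y))" by (intro continuous_intros)
  from open_vimage[OF assms this] show ?thesis by (simp add: vimage_def)
qed

text \<open>The value \<open>l = 0\<close> is excluded because \<open>(0, 0)\<close> is critical.
  The lower bound is strict because \<open>U\<close> also contains a point of the image with a
  smaller first coordinate \<open>l - e / 2\<close>, which is at least
  \<open>- 2 * lam\<close>.\<close>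

lemma regular_value_in_open_bounds:
  assumes "lam > 0" "mu > 0" "open U" "(l, 0) \<in> U" "U \<subseteq> regular_values_in_image lam mu"
  shows "- 2 * lam < l" "l \<noteq> 0"
proof -
  show "l \<noteq> 0"
    using assms not_regular_value_0 by (auto simp: regular_values_in_image_def)
  have "open {x. (x, 0) \<in> U}"
    by (rule open_section) fact
  then obtain e where "e > 0" "ball l e \<subseteq> {x. (x, 0) \<in> U}"
    using assms(4) by (auto simp: open_contains_ball)
  then have "(l - e / 2, 0) \<in> U" by (auto simp: subset_iff dist_real_def)
  then obtain m where "m \<in> phase_space" "L_ham lam mu m = l - e / 2"
    using assms(5) by (force simp: regular_values_in_image_def F_map_def)
  then show "- 2 * lam < l" using L_ham_ge[OF assms(1,2)] \<open>e > 0\<close> by fastforce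
qed

text \<open>The solutions of \<open>cos y = - 1\<close> are the odd multiples of \<open>pi\<close>,
  a set with gaps of length \<open>2 * pi\<close>, and a continuous function on a connected set
  cannot jump across them.\<close>

lemma cos_eq_minus_1_constant_on:
  fixes f :: "real \<Rightarrow> real"
  assumes "connected S" "continuous_on S f" "\<And>x. x \<in> S \<Longrightarrow> cos (f x) = - 1"
  shows "f constant_on S"
proof (rule continuous_discrete_range_constant[OF assms(1,2)])
  have int: "\<exists>j::int. f x = 2 * pi * of_int j + pi" if x: "x \<in> S" for x
  proof -
    have "cos (f x - pi) = 1" using assms(3)[OF x] by (simp add: cos_diff)
    then obtain j :: int where "f x - pi = of_int j * 2 * pi"
      unfolding cos_one_2pi_int by blast
    then show ?thesis by (intro exI[of _ j]) (simp add: algebra_simps)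
  qed
  show "\<exists>e>0. \<forall>y. y \<in> S \<and> f y \<noteq> f x \<longrightarrow> e \<le> norm (f y - f x)" if x: "x \<in> S" for x
  proof (intro exI[of _ "2 * pi"] conjI allI impI)
    fix y assume y: "y \<in> S \<and> f y \<noteq> f x"
    obtain i j :: int where ij: "f x = 2 * pi * of_int i + pi" "f y = 2 * pi * of_int j + pi"
      using int x y by blast
    then have "1 \<le> \<bar>real_of_int (j - i)\<bar>" using y by auto
    then have "2 * pi * 1 \<le> 2 * pi * \<bar>real_of_int (j - i)\<bar>" by (intro mult_left_mono) auto
    also have "\<dots> = \<bar>2 * pi * real_of_int (j - i)\<bar>" by (simp add: abs_mult)
    finally show "2 * pi \<le> norm (f y - f x)" by (simp add: ij algebra_simps)
  qed simp
qed

theorem theoremB: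
  fixes lam mu l :: real and act :: "real \<times> real \<Rightarrow> real"
  assumes "lam > 0" and "mu > 0"
    and "(l, 0) \<in> regular_values_in_image lam mu"
    and "smooth_action_branch lam mu (l, 0) act"
  shows "twist act l 0 = 0"
proof -
  obtain U where U: "open U" "(l, 0) \<in> U" "U \<subseteq> regular_values_in_image lam mu"
    and smooth: "smooth_function_on U act"
    and vals: "\<And>l h. (l, h) \<in> U \<Longrightarrow> h \<noteq> 0 \<Longrightarrow> act (l, h) \<in> action_values lam mu (l, h)"
    using assms(4) unfolding smooth_action_branch_def by fast
  have contU: "continuous_on U act"
    using smooth Ck_on.simps(1) unfolding smooth_function_on_def by blast
  note bounds = regular_value_in_open_bounds[OF assms(1,2) U(1) _ U(3)]
  have "open {x. (x, 0) \<in> U}"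
    by (rule open_section) fact
  then obtain e where e: "e > 0" "ball l e \<subseteq> {x. (x, 0) \<in> U}"
    using U(2) by (auto simp: open_contains_ball)
  \<comment> \<open>Radius \<open>e\<close> keeps \<open>(x, 0)\<close> in \<open>U\<close>; radius
    \<open>\<bar>l\<bar>\<close> keeps \<open>x\<close> on the same side of 0 as \<open>l\<close>,
    so that \<open>max 0 x\<close> is given by one affine formula.\<close>
  define d where "d = min e \<bar>l\<bar>"
  have "d > 0" using e bounds(2)[OF U(2)] by (auto simp: d_def)
  define B where "B = ball l d"
  have BU: "(x, 0) \<in> U" if "x \<in> B" for x using that e by (auto simp: B_def d_def)
  have sign: "0 < x \<longleftrightarrow> 0 < l" if "x \<in> B" for x
    using that by (auto simp: B_def d_def dist_real_def)
  define D where "D x = x + 2 * lam - max 0 x" for x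
  have Dpos: "D x > 0" if "x \<in> B" for x
    using bounds(1)[OF BU[OF that]] assms(1) by (auto simp: D_def)
  have cos: "cos (2 * pi * act (x, 0) / D x) = - 1" if x: "x \<in> B" for x
    unfolding D_def
  proof (rule cos_action_zero[OF assms(1,2) bounds(1)[OF BU[OF x]]])
    have "isCont act (x, 0)" using contU U(1) BU[OF x] continuous_on_eq_continuous_at by blast
    moreover have "isCont (\<lambda>h. (x, h)) 0" by (intro continuous_intros)
    ultimately show "isCont (\<lambda>h. act (x, h)) 0" using isCont_o2 by blast
    \<comment> \<open>The branch is tied to action values only for nonzero \<open>h\<close>, so the
      value at \<open>h = 0\<close> is approached from the right inside \<open>U\<close>.\<close>
    have "((\<lambda>h. (x, h)) \<longlongrightarrow> (x, 0)) (at_right 0)" by (intro tendsto_intros)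
    from topological_tendstoD[OF this U(1) BU[OF x]]
    have "\<forall>\<^sub>F h in at_right 0. (x, h) \<in> U" .
    moreover have "\<forall>\<^sub>F h in at_right (0::real). 0 < h" by (rule eventually_at_right_less)
    ultimately show "\<forall>\<^sub>F h in at_right 0. act (x, h) \<in> action_values lam mu (x, h)"
      by eventually_elim (use vals in auto)
  qed
  have "continuous_on B (\<lambda>x. act (x, 0))"
    by (rule continuous_on_compose2[OF contU, of B "\<lambda>x. (x, 0)"])
      (use BU in \<open>auto intro!: continuous_intros\<close>)
  then have "continuous_on B (\<lambda>x. 2 * pi * act (x, 0) / D x)"
    unfolding D_def using Dpos by (intro continuous_intros) (force simp: D_def)+
  moreover have "connected B" unfolding B_def by simp
  ultimately have "(\<lambda>x. 2 * pi * act (x, 0) / D x) constant_on B"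
    using cos_eq_minus_1_constant_on cos by blast
  then obtain c where c: "\<And>x. x \<in> B \<Longrightarrow> 2 * pi * act (x, 0) / D x = c"
    unfolding constant_on_def by blast
  \<comment> \<open>On \<open>B\<close> the length \<open>D x\<close> is \<open>2 * lam\<close> if
    \<open>l > 0\<close> and \<open>x + 2 * lam\<close> if \<open>l < 0\<close>; multiplying by
    \<open>c / (2 * pi)\<close> gives these coefficients.\<close>
  define \<alpha> \<beta> where "\<alpha> = (if l > 0 then 0 else c / (2 * pi))" and "\<beta> = c / (2 * pi) * (2 * lam)"
  have affine: "act (x, 0) = \<alpha> * x + \<beta>" if x: "x \<in> B" for x
  proof -
    have "act (x, 0) = c / (2 * pi) * D x" using c[OF x] Dpos[OF x] by (auto simp: field_simps)
    moreover have "D x = (if l > 0 then 0 else x) + 2 * lam" using sign[OF x] by (auto simp: D_def)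
    ultimately show ?thesis by (simp add: \<alpha>_def \<beta>_def algebra_simps)
  qed
  have openB: "open B" "l \<in> B" using \<open>d > 0\<close> by (auto simp: B_def)
  have "rotation_number act x 0 = - \<alpha>" if x: "x \<in> B" for x
  proof -
    have "((\<lambda>x. \<alpha> * x + \<beta>) has_real_derivative \<alpha>) (at x)"
      by (auto intro!: derivative_eq_intros)
    then have "((\<lambda>x. act (x, 0)) has_real_derivative \<alpha>) (at x)"
      using has_field_derivative_transform_within_open[OF _ openB(1) x] affine by simp
    then show ?thesis by (simp add: rotation_number_def DERIV_imp_deriv)
  qed
  then have "((\<lambda>x. rotation_number act x 0) has_real_derivative 0) (at l)"
    using has_field_derivative_transform_within_open[OF DERIV_const openB] by simp
  then show ?thesis by (simp add: twist_def DERIV_imp_deriv)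
qed

end
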